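(* Fix $r_1, r_2 \in \mathbb{N}$. Let $\{G_n\}_{n=1}^{\infty}$ be a family of finite groups, each of which admits an unmixed ramification structure of size $(r_1,r_2)$. Let $\tau_{n,1}=(m_{n,1,1},\dots,m_{n,1,r_1})$ and $\tau_{n,2}=(m_{n,2,1},\dots,m_{n,2,r_2})$ be sequences of types such that $(\tau_{n,1},\tau_{n,2})$ is the type of an unmixed ramification structure for $G_n$, and let $\{S_n\}_{n=1}^{\infty}$ be the family of surfaces isogenous to a product with $q=0$ admitting the given data (that is, $S_n$ is of unmixed type with group $G_n$ and ramification structure of type $(\tau_{n,1},\tau_{n,2})$). Then, as $|G_n| \to \infty$ for $n\to\infty$: (i) $\chi(S_n)=\Theta(|G_n|)$; (ii) $h(G_n;\tau_{n,1},\tau_{n,2}) = O\bigl(\chi(S_n)^{r_1+r_2-2}\bigr)$.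
   Context: Systems of generators. Let $G$ be a finite group and $\tau=(m_1,\dots,m_r)$ a tuple of positive integers. A system of generators of $G$ of type $\tau$ (with quotient genus $0$) is an $r$-tuple $\mathcal V=(c_1,\dots,c_r)$ of elements of $G$ that generate $G$, with $c_1c_2\cdots c_r=1$ and $\mathrm{ord}(c_i)=m_i$ for all $i$. It is of unordered type $\tau$ if there is a permutation $\sigma\in\mathfrak S_r$ with $\mathrm{ord}(c_i)=m_{\sigma(i)}$ for all $i$. Put $\Sigma(\mathcal V)=\bigcup_{g\in G}\bigcup_{j\ge 0}\bigcup_{k=1}^r \{g c_k^j g^{-1}\}$. Two systems $\mathcal V_1,\mathcal V_2$ are disjoint if $\Sigma(\mathcal V_1)\cap\Sigma(\mathcal V_2)=\{1\}$. Ramification structures. An unmixed ramification structure of type $(\tau_1,\tau_2)$ for $G$, where $\tau_i=(m_{i,1},\dots,m_{i,r_i})$, is a pair $(\mathcal V_1,\mathcal V_2)$ of disjoint systems of generators of $G$ of types $\tau_1,\tau_2$ such that $\tfrac12|G|\bigl(-2+\sum_{l=1}^{r_i}(1-\tfrac1{m_{i,l}})\bigr)+1$ is an integer $\ge 2$ for $i=1,2$. Its size is $(r_1,r_2)$. Let $\mathcal U(G;\tau_1,\tau_2)$ be the set of all pairs $(\mathcal V_1,\mathcal V_2)$ of disjoint systems of generators of $G$ with $\mathcal V_1$ of unordered type $\tau_1$ and $\mathcal V_2$ of unordered type $\tau_2$. Surfaces. A surface isogenous to a (higher) product of curves is $S=(C_1\times C_2)/G$, where $C_1,C_2$ are smooth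 compact complex curves of genus at least $2$ and $G$ is a finite group acting freely on $C_1\times C_2$. Only the unmixed type is considered: $G$ acts faithfully on each $C_i$ and diagonally on the product. The irregularity is $q(S)=g(C_1/G)+g(C_2/G)$, so $q(S)=0$ means $C_i/G\cong\mathbb P^1$ for $i=1,2$. In this case $S$ is determined via the monodromies of the coverings $C_i\to C_i/G$ by $G$ together with an unmixed ramification structure of some type $(\tau_1,\tau_2)$, where $\tau_i$ lists the branching indices of $C_i\to\mathbb P^1$. The holomorphic Euler characteristic is $\chi(S)=\chi(\mathcal O_S)=\frac{(g(C_1)-1)(g(C_2)-1)}{|G|}$, equivalently $4\chi(S)=|G|\prod_{i=1}^2\bigl(-2+\sum_{k=1}^{r_i}(1-\tfrac1{m_{i,k}})\bigr)$. Hurwitz components. The braid group $\mathbf B_r=\langle\sigma_1,\dots,\sigma_{r-1}\mid \sigma_i\sigma_{i+1}\sigma_i=\sigma_{i+1}\sigma_i\sigma_{i+1},\ \sigma_i\sigma_j=\sigma_j\sigma_i \text{ if } |i-j|\ge2\rangle$ acts on $r$-tuples by $\sigma_i:(c_1,\dots,c_r)\mapsto(c_1,\dots,c_{i-1},c_{i+1},c_{i+1}^{-1}c_ic_{i+1},c_{i+2},\dots,c_r)$. The number $h(G;\tau_1,\tau_2)$ of Hurwitz components is the number of orbits of $\mathcal U(G;\tau_1,\tau_2)$ under the following action: if $\tau_1\ne\tau_2$, the action of $(\mathbf B_{r_1}\times\mathbf B_{r_2})\times\mathrm{Aut}(G)$ given by $((\gamma_1,\gamma_2),\phi)\cdot(T_1,T_2)=(\phi(\gamma_1(T_1)),\phi(\gamma_2(T_2)))$;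 if $\tau_1=\tau_2$ (and $r=r_1=r_2$), the action of $(\mathbf B_r\wr\mathbb Z/2\mathbb Z)\times\mathrm{Aut}(G)$, where in addition $\mathbb Z/2\mathbb Z$ exchanges $T_1$ and $T_2$. Asymptotics. $f(n)=\Theta(g(n))$ means $c_1g(n)\le f(n)\le c_2g(n)$ for some positive constants $c_1,c_2$, as $n\to\infty$; $f(n)=O(g(n))$ means $f(n)\le c\,g(n)$ for some positive constant $c$, as $n\to\infty$. *)

theory Defs
  imports
    "HOL-Algebra.Generated_Groups"
    "HOL-Algebra.Multiplicative_Group"
    "HOL-Algebra.Group_Action"
    "HOL-Algebra.Bij"
    "HOL-Combinatorics.Permutations"
    "HOL-Library.Landau_Symbols"
begin

section \<open>Systems of generators\<close>

text \<open>Tuples are lists: the entry \<open>c\<^sub>i\<close> of \<open>V = (c\<^sub>1, \<dots>, c\<^sub>r)\<close> is \<open>V ! (i - 1)\<close>.\<close>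

definition generating_tuple :: "('a, 'b) monoid_scheme \<Rightarrow> 'a list \<Rightarrow> bool" where
  "generating_tuple G V \<longleftrightarrow>
     set V \<subseteq> carrier G \<and>
     generate G (set V) = carrier G \<and>
     foldr (\<lambda>x y. x \<otimes>\<^bsub>G\<^esub> y) V \<one>\<^bsub>G\<^esub> = \<one>\<^bsub>G\<^esub>"

definition system_of_type :: "('a, 'b) monoid_scheme \<Rightarrow> nat list \<Rightarrow> 'a list \<Rightarrow> bool" where
  "system_of_type G \<tau> V \<longleftrightarrow>
     generating_tuple G V \<and> length V = length \<tau> \<and>
     (\<forall>i<length \<tau>. group.ord G (V ! i) = \<tau> ! i)"

definition system_of_unordered_type ::
    "('a, 'b) monoid_scheme \<Rightarrow> nat list \<Rightarrow> 'a list \<Rightarrow> bool" where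
  "system_of_unordered_type G \<tau> V \<longleftrightarrow>
     generating_tuple G V \<and> length V = length \<tau> \<and>
     (\<exists>\<sigma>. \<sigma> permutes {..<length \<tau>} \<and>
          (\<forall>i<length \<tau>. group.ord G (V ! i) = \<tau> ! \<sigma> i))"

definition Sigma_set :: "('a, 'b) monoid_scheme \<Rightarrow> 'a list \<Rightarrow> 'a set" where
  "Sigma_set G V =
     (\<Union>g\<in>carrier G. \<Union>j::nat. \<Union>c\<in>set V. {g \<otimes>\<^bsub>G\<^esub> (c [^]\<^bsub>G\<^esub> j) \<otimes>\<^bsub>G\<^esub> inv\<^bsub>G\<^esub> g})"

definition disjoint_systems :: "('a, 'b) monoid_scheme \<Rightarrow> 'a list \<Rightarrow> 'a list \<Rightarrow> bool" where
  "disjoint_systems G V1 V2 \<longleftrightarrow> Sigma_set G V1 \<inter> Sigma_set G V2 = {\<one>\<^bsub>G\<^esub>}"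


section \<open>Ramification structures\<close>

text \<open>The genus, by Riemann--Hurwitz, of a Galois covering of the projective line with group
  \<open>G\<close> and branching indices \<open>\<tau>\<close>.\<close>

definition covering_genus :: "('a, 'b) monoid_scheme \<Rightarrow> nat list \<Rightarrow> real" where
  "covering_genus G \<tau> =
     1 / 2 * real (order G) * (- 2 + (\<Sum>l<length \<tau>. 1 - 1 / real (\<tau> ! l))) + 1"

definition unmixed_ramification_structure ::
    "('a, 'b) monoid_scheme \<Rightarrow> nat list \<Rightarrow> nat list \<Rightarrow> 'a list \<Rightarrow> 'a list \<Rightarrow> bool" where
  "unmixed_ramification_structure G \<tau>1 \<tau>2 V1 V2 \<longleftrightarrow>
     system_of_type G \<tau>1 V1 \<and> system_of_type G \<tau>2 V2 \<and> disjoint_systems G V1 V2 \<and>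
     (\<forall>\<tau>\<in>{\<tau>1, \<tau>2}. covering_genus G \<tau> \<in> \<int> \<and> covering_genus G \<tau> \<ge> 2)"

definition type_of_unmixed_ramification_structure ::
    "('a, 'b) monoid_scheme \<Rightarrow> nat list \<Rightarrow> nat list \<Rightarrow> bool" where
  "type_of_unmixed_ramification_structure G \<tau>1 \<tau>2 \<longleftrightarrow>
     (\<exists>V1 V2. unmixed_ramification_structure G \<tau>1 \<tau>2 V1 V2)"

definition admits_unmixed_ramification_structure_of_size ::
    "('a, 'b) monoid_scheme \<Rightarrow> nat \<Rightarrow> nat \<Rightarrow> bool" where
  "admits_unmixed_ramification_structure_of_size G r1 r2 \<longleftrightarrow>
     (\<exists>\<tau>1 \<tau>2. length \<tau>1 = r1 \<and> length \<tau>2 = r2 \<and>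
              type_of_unmixed_ramification_structure G \<tau>1 \<tau>2)"

definition U_set :: "('a, 'b) monoid_scheme \<Rightarrow> nat list \<Rightarrow> nat list \<Rightarrow> ('a list \<times> 'a list) set" where
  "U_set G \<tau>1 \<tau>2 =
     {(V1, V2). system_of_unordered_type G \<tau>1 V1 \<and> system_of_unordered_type G \<tau>2 V2 \<and>
                disjoint_systems G V1 V2}"


section \<open>Surfaces isogenous to a product\<close>

text \<open>A surface \<open>S = (C\<^sub>1 \<times> C\<^sub>2) / G\<close> isogenous to a product, of unmixed type and with \<open>q(S) = 0\<close>,
  is represented by the data that determine it: the group \<open>G\<close> and the monodromies of the two
  Galois coverings \<open>C\<^sub>i \<rightarrow> C\<^sub>i / G\<close> of the projective line. Disjointness of the two systems says
  that the diagonal action on \<open>C\<^sub>1 \<times> C\<^sub>2\<close> is free, and by Riemann's existence theorem every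
  unmixed ramification structure arises in this way.\<close>

datatype 'a product_quotient =
  Product_Quotient (surf_group: "'a monoid") (monodromy1: "'a list") (monodromy2: "'a list")

definition isogenous_to_product_q0 ::
    "'a monoid \<Rightarrow> nat list \<Rightarrow> nat list \<Rightarrow> 'a product_quotient \<Rightarrow> bool" where
  "isogenous_to_product_q0 G \<tau>1 \<tau>2 S \<longleftrightarrow>
     group G \<and> finite (carrier G) \<and> surf_group S = G \<and>
     unmixed_ramification_structure G \<tau>1 \<tau>2 (monodromy1 S) (monodromy2 S)"

text \<open>The branching indices of \<open>C\<^sub>i \<rightarrow> C\<^sub>i / G\<close> are the orders of the local monodromies.\<close>

definition genus1 :: "'a product_quotient \<Rightarrow> real" where
  "genus1 S = covering_genus (surf_group S) (map (group.ord (surf_group S)) (monodromy1 S))"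

definition genus2 :: "'a product_quotient \<Rightarrow> real" where
  "genus2 S = covering_genus (surf_group S) (map (group.ord (surf_group S)) (monodromy2 S))"

text \<open>The holomorphic Euler characteristic \<open>\<chi>(\<O>\<^sub>S) = (g(C\<^sub>1) - 1) (g(C\<^sub>2) - 1) / |G|\<close>.\<close>

definition chi :: "'a product_quotient \<Rightarrow> real" where
  "chi S = (genus1 S - 1) * (genus2 S - 1) / real (order (surf_group S))"

lemma system_of_type_orders:
  assumes "system_of_type G \<tau> V"
  shows "map (group.ord G) V = \<tau>"
  using assms by (auto simp: system_of_type_def intro: nth_equalityI)

lemma four_chi:
  assumes "isogenous_to_product_q0 G \<tau>1 \<tau>2 S"
  shows "4 * chi S = real (order G) *
           ((- 2 + (\<Sum>k<length \<tau>1. 1 - 1 / real (\<tau>1 ! k))) *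
            (- 2 + (\<Sum>k<length \<tau>2. 1 - 1 / real (\<tau>2 ! k))))"
proof -
  interpret group G using assms by (simp add: isogenous_to_product_q0_def)
  have pos: "order G > 0"
    using assms by (simp add: isogenous_to_product_q0_def order_gt_0_iff_finite)
  have "surf_group S = G" "genus1 S = covering_genus G \<tau>1" "genus2 S = covering_genus G \<tau>2"
    using assms system_of_type_orders[of G \<tau>1 "monodromy1 S"]
      system_of_type_orders[of G \<tau>2 "monodromy2 S"]
    by (simp_all add: isogenous_to_product_q0_def unmixed_ramification_structure_def
        genus1_def genus2_def)
  with pos show ?thesis
    by (simp add: chi_def covering_genus_def)
qed


section \<open>The braid group and its action on tuples\<close>

text \<open>A word in the letters \<open>\<sigma>\<^sub>i\<close> and their inverses is a list of pairs: \<open>(True, i)\<close> stands for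
  \<open>\<sigma>\<^sub>i\<close> and \<open>(False, i)\<close> for its inverse.\<close>

type_synonym braid_word = "(bool \<times> nat) list"

definition braid_words :: "nat \<Rightarrow> braid_word set" where
  "braid_words r = lists (UNIV \<times> {1..<r})"

inductive braid_eq :: "nat \<Rightarrow> braid_word \<Rightarrow> braid_word \<Rightarrow> bool" for r where
  refl: "u \<in> braid_words r \<Longrightarrow> braid_eq r u u"
| sym: "braid_eq r u v \<Longrightarrow> braid_eq r v u"
| trans: "braid_eq r u v \<Longrightarrow> braid_eq r v w \<Longrightarrow> braid_eq r u w"
| cong: "braid_eq r u u' \<Longrightarrow> braid_eq r v v' \<Longrightarrow> braid_eq r (u @ v) (u' @ v')"
| cancel: "i \<in> {1..<r} \<Longrightarrow> braid_eq r [(b, i), (\<not> b, i)] []"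
| braid: "i \<in> {1..<r} \<Longrightarrow> i + 1 \<in> {1..<r} \<Longrightarrow>
    braid_eq r [(True, i), (True, i + 1), (True, i)] [(True, i + 1), (True, i), (True, i + 1)]"
| comm: "i \<in> {1..<r} \<Longrightarrow> j \<in> {1..<r} \<Longrightarrow> i + 2 \<le> j \<or> j + 2 \<le> i \<Longrightarrow>
    braid_eq r [(True, i), (True, j)] [(True, j), (True, i)]"

definition braid_rel :: "nat \<Rightarrow> (braid_word \<times> braid_word) set" where
  "braid_rel r = {(u, v). braid_eq r u v}"

definition braid_group :: "nat \<Rightarrow> braid_word set monoid" where
  "braid_group r =
     \<lparr>carrier = braid_words r // braid_rel r,
      monoid.mult = (\<lambda>A B. \<Union>u\<in>A. \<Union>v\<in>B. braid_rel r `` {u @ v}),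
      one = braid_rel r `` {[]}\<rparr>"

fun letter_act :: "('a, 'b) monoid_scheme \<Rightarrow> bool \<times> nat \<Rightarrow> 'a list \<Rightarrow> 'a list" where
  "letter_act G (True, i) T =
     T[i - 1 := T ! i, i := inv\<^bsub>G\<^esub> (T ! i) \<otimes>\<^bsub>G\<^esub> T ! (i - 1) \<otimes>\<^bsub>G\<^esub> T ! i]"
| "letter_act G (False, i) T =
     T[i - 1 := T ! (i - 1) \<otimes>\<^bsub>G\<^esub> T ! i \<otimes>\<^bsub>G\<^esub> inv\<^bsub>G\<^esub> (T ! (i - 1)), i := T ! (i - 1)]"

definition word_act :: "('a, 'b) monoid_scheme \<Rightarrow> braid_word \<Rightarrow> 'a list \<Rightarrow> 'a list" where
  "word_act G w T = foldr (letter_act G) w T"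

text \<open>An element of the braid group acts through any of its representing words; by the lemma
  \<open>braid_act_class\<close> below the choice is immaterial.\<close>

definition braid_act :: "('a, 'b) monoid_scheme \<Rightarrow> braid_word set \<Rightarrow> 'a list \<Rightarrow> 'a list" where
  "braid_act G \<gamma> T = word_act G (SOME w. w \<in> \<gamma>) T"

lemma braid_eq_words:
  assumes "braid_eq r u v"
  shows "u \<in> braid_words r \<and> v \<in> braid_words r"
  using assms by induction (auto simp: braid_words_def)

lemma equiv_braid_rel: "equiv (braid_words r) (braid_rel r)"
  using braid_eq_words
  by (intro equivI refl_onI symI transI)
    (auto simp: braid_rel_def intro: braid_eq.refl braid_eq.sym braid_eq.trans)

lemma group_braid_group: "group (braid_group r)"
proof (rule groupI)
  note e = equiv_braid_rel[of r]
  let ?c = "\<lambda>w. braid_rel r `` {w}"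
  have c: "\<exists>u\<in>braid_words r. A = ?c u" if "A \<in> carrier (braid_group r)" for A
    using that by (auto simp: braid_group_def elim!: quotientE)
  have mem: "?c u \<in> carrier (braid_group r)" if "u \<in> braid_words r" for u
    using that by (auto simp: braid_group_def intro: quotientI)
  have app: "u @ v \<in> braid_words r" if "u \<in> braid_words r" "v \<in> braid_words r" for u v
    using that by (auto simp: braid_words_def)
  have nil: "[] \<in> braid_words r" by (simp add: braid_words_def)
  have m: "?c u \<otimes>\<^bsub>braid_group r\<^esub> ?c v = ?c (u @ v)"
    if "u \<in> braid_words r" "v \<in> braid_words r" for u v
  proof -
    have "?c (u' @ v') = ?c (u @ v)" if "u' \<in> ?c u" "v' \<in> ?c v" for u' v'
      using that by (intro equiv_class_eq[OF e])
        (auto simp: braid_rel_def intro: braid_eq.cong braid_eq.sym)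
    then have "(\<Union>u'\<in>?c u. \<Union>v'\<in>?c v. ?c (u' @ v')) = (\<Union>u'\<in>?c u. \<Union>v'\<in>?c v. ?c (u @ v))"
      by (intro SUP_cong HOL.refl) blast
    moreover have "?c u \<noteq> {}" "?c v \<noteq> {}"
      using equiv_class_self[OF e] that by blast+
    ultimately show ?thesis by (simp add: braid_group_def)
  qed
  have one: "\<one>\<^bsub>braid_group r\<^esub> = ?c []" by (simp add: braid_group_def)
  show "\<one>\<^bsub>braid_group r\<^esub> \<in> carrier (braid_group r)"
    using mem nil one by simp
  fix A assume A: "A \<in> carrier (braid_group r)"
  then obtain u where u: "u \<in> braid_words r" "A = ?c u" using c by blast
  show "\<one>\<^bsub>braid_group r\<^esub> \<otimes>\<^bsub>braid_group r\<^esub> A = A"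
    using u one m nil by simp
  have "\<exists>v\<in>braid_words r. braid_eq r (v @ u) []"
    using u(1)
  proof (induction u)
    case Nil
    then show ?case using nil braid_eq.refl by fastforce
  next
    case (Cons a u)
    obtain b i where a: "a = (b, i)" by fastforce
    from Cons have i: "i \<in> {1..<r}" and u: "u \<in> braid_words r"
      by (auto simp: a braid_words_def)
    with Cons obtain v where v: "v \<in> braid_words r" "braid_eq r (v @ u) []" by auto
    have "braid_eq r (v @ [(\<not> b, i), (b, i)] @ u) (v @ [] @ u)"
      using braid_eq.cancel[OF i, of "\<not> b"] u v
      by (intro braid_eq.cong) (auto intro: braid_eq.refl)
    with v have "braid_eq r ((v @ [(\<not> b, i)]) @ a # u) []"
      by (auto simp: a intro: braid_eq.trans)
    moreover have "v @ [(\<not> b, i)] \<in> braid_words r"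
      using v i by (auto simp: braid_words_def)
    ultimately show ?case by blast
  qed
  then obtain v where v: "v \<in> braid_words r" "braid_eq r (v @ u) []" by blast
  then have "?c (v @ u) = ?c []"
    by (intro equiv_class_eq[OF e]) (simp add: braid_rel_def)
  then show "\<exists>B\<in>carrier (braid_group r). B \<otimes>\<^bsub>braid_group r\<^esub> A = \<one>\<^bsub>braid_group r\<^esub>"
    using m u v one mem by metis
  fix B assume "B \<in> carrier (braid_group r)"
  then obtain v where v: "v \<in> braid_words r" "B = ?c v" using c by blast
  show "A \<otimes>\<^bsub>braid_group r\<^esub> B \<in> carrier (braid_group r)"
    using u v m mem app by simp
  fix C assume "C \<in> carrier (braid_group r)"
  then obtain w where w: "w \<in> braid_words r" "C = ?c w" using c by blast
  show "A \<otimes>\<^bsub>braid_group r\<^esub> B \<otimes>\<^bsub>braid_group r\<^esub> C = A \<otimes>\<^bsub>braid_group r\<^esub> (B \<otimes>\<^bsub>braid_group r\<^esub> C)"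
    using u v w m app by simp
qed

lemma letter_act_tuple:
  assumes "group G" "set T \<subseteq> carrier G" "i \<in> {1..<length T}"
  shows "set (letter_act G (b, i) T) \<subseteq> carrier G" "length (letter_act G (b, i) T) = length T"
proof -
  interpret group G by fact
  have "T ! i \<in> carrier G" "T ! (i - 1) \<in> carrier G"
    using assms by (auto simp: subset_iff)
  then show "set (letter_act G (b, i) T) \<subseteq> carrier G"
    using assms by (cases b) (auto dest!: subsetD[OF set_update_subset_insert])
  show "length (letter_act G (b, i) T) = length T"
    by (cases b) auto
qed

lemma word_act_tuple:
  assumes "group G" "set T \<subseteq> carrier G" "w \<in> braid_words (length T)"
  shows "set (word_act G w T) \<subseteq> carrier G \<and> length (word_act G w T) = length T"
  using assms(3)
proof (induction w)
  case Nil
  then show ?case using assms by (simp add: word_act_def)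
next
  case (Cons a w)
  obtain b i where a: "a = (b, i)" by fastforce
  with Cons letter_act_tuple[OF assms(1), of "word_act G w T" i b]
  show ?case by (auto simp: word_act_def braid_words_def)
qed

lemma word_act_cancel:
  assumes "group G" "set T \<subseteq> carrier G" "1 \<le> i" "i < length T"
  shows "word_act G [(b, i), (\<not> b, i)] T = T"
proof -
  interpret group G by fact
  obtain k where k: "i = Suc k" using assms(3) by (cases i) auto
  have T: "T = take k T @ T ! k # T ! Suc k # drop (Suc (Suc k)) T"
    using assms(4) k by (simp add: Cons_nth_drop_Suc)
  obtain xs x y ys where *: "T = xs @ x # y # ys" "length xs = k"
    using T assms(4) k by (metis add_lessD1 length_take min.absorb2 less_imp_le_nat Suc_lessD Suc_eq_plus1)
  have **: "a \<otimes>\<^bsub>G\<^esub> (inv\<^bsub>G\<^esub> a \<otimes>\<^bsub>G\<^esub> z) = z" "inv\<^bsub>G\<^esub> a \<otimes>\<^bsub>G\<^esub> (a \<otimes>\<^bsub>G\<^esub> z) = z"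
    if "a \<in> carrier G" "z \<in> carrier G" for a z
    using that by (simp_all flip: m_assoc)
  have "x \<in> carrier G" "y \<in> carrier G" using * assms(2) by auto
  then show ?thesis
    by (cases b) (simp_all add: word_act_def * k nth_append list_update_append m_assoc **)
qed

lemma word_act_braid:
  assumes "group G" "set T \<subseteq> carrier G" "1 \<le> i" "i + 1 < length T"
  shows "word_act G [(True, i), (True, i + 1), (True, i)] T
    = word_act G [(True, i + 1), (True, i), (True, i + 1)] T"
proof -
  interpret group G by fact
  obtain k where k: "i = Suc k" using assms(3) by (cases i) auto
  have T: "T = take k T @ T ! k # T ! Suc k # T ! Suc (Suc k) # drop (Suc (Suc (Suc k))) T"
    using assms(4) k by (simp add: Cons_nth_drop_Suc)
  obtain xs a b c ys where *: "T = xs @ a # b # c # ys" "length xs = k"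
    using T assms(4) k by (metis add_lessD1 length_take min.absorb2 less_imp_le_nat Suc_lessD Suc_eq_plus1)
  have **: "x \<otimes>\<^bsub>G\<^esub> (inv\<^bsub>G\<^esub> x \<otimes>\<^bsub>G\<^esub> y) = y" "inv\<^bsub>G\<^esub> x \<otimes>\<^bsub>G\<^esub> (x \<otimes>\<^bsub>G\<^esub> y) = y"
    if "x \<in> carrier G" "y \<in> carrier G" for x y
    using that by (simp_all flip: m_assoc)
  have "a \<in> carrier G" "b \<in> carrier G" "c \<in> carrier G" using * assms(2) by auto
  then show ?thesis
    by (simp add: word_act_def * k nth_append list_update_append m_assoc inv_mult_group **)
qed

lemma word_act_comm:
  assumes "1 \<le> i" "i < length T" "j < length T" "i + 2 \<le> j"
  shows "word_act G [(True, i), (True, j)] T = word_act G [(True, j), (True, i)] T"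
proof -
  have "i \<noteq> j" "i - 1 \<noteq> j" "i \<noteq> j - 1" "i - 1 \<noteq> j - 1" using assms by auto
  then show ?thesis
    by (simp add: word_act_def list_update_swap)
qed

lemma word_act_eq:
  assumes "group G" "braid_eq (length T) u v" "set T \<subseteq> carrier G"
  shows "word_act G u T = word_act G v T"
proof -
  interpret group G by fact
  have "\<forall>T. set T \<subseteq> carrier G \<and> length T = r \<longrightarrow> word_act G u T = word_act G v T"
    if "braid_eq r u v" for r
    using that
  proof induction
    case (cong u u' v v')
    show ?case
    proof (intro allI impI)
      fix T assume T: "set T \<subseteq> carrier G \<and> length T = r"
      have "set (word_act G v T) \<subseteq> carrier G \<and> length (word_act G v T) = r"
        using word_act_tuple[of G T v] T braid_eq_words[OF cong(2)] \<open>group G\<close> by auto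
      with cong T show "word_act G (u @ v) T = word_act G (u' @ v') T"
        by (simp add: word_act_def)
    qed
  next
    case (cancel i b)
    then show ?case
      using word_act_cancel[OF \<open>group G\<close>] by (auto simp: word_act_def[of G "[]"])
  next
    case (braid i)
    then show ?case
      using word_act_braid[OF \<open>group G\<close>] by auto
  next
    case (comm i j)
    then show ?case
      using word_act_comm[of i _ j G] word_act_comm[of j _ i G] by fastforce
  qed auto
  with assms show ?thesis by auto
qed

lemma braid_act_class:
  assumes "group G" "set T \<subseteq> carrier G" "\<gamma> \<in> carrier (braid_group (length T))" "w \<in> \<gamma>"
  shows "braid_act G \<gamma> T = word_act G w T"
proof -
  have "(SOME w. w \<in> \<gamma>) \<in> \<gamma>" using assms(4) by (rule someI)
  then have "braid_eq (length T) (SOME w. w \<in> \<gamma>) w"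
    using quotient_eq_iff[OF equiv_braid_rel, of \<gamma> "length T" \<gamma>] assms(3,4)
    by (auto simp: braid_group_def braid_rel_def)
  then show ?thesis
    using word_act_eq assms by (auto simp: braid_act_def)
qed


section \<open>Hurwitz components\<close>

text \<open>The wreath product with \<open>\<int>/2\<int>\<close>, whose nontrivial element is \<open>True\<close>.\<close>

definition wreath_Z2 :: "('g, 'b) monoid_scheme \<Rightarrow> (('g \<times> 'g) \<times> bool) monoid" where
  "wreath_Z2 B =
     \<lparr>carrier = (carrier B \<times> carrier B) \<times> UNIV,
      monoid.mult = (\<lambda>((a1, a2), e) ((b1, b2), f).
        (if e then (a1 \<otimes>\<^bsub>B\<^esub> b2, a2 \<otimes>\<^bsub>B\<^esub> b1) else (a1 \<otimes>\<^bsub>B\<^esub> b1, a2 \<otimes>\<^bsub>B\<^esub> b2), e \<noteq> f)),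
      one = ((\<one>\<^bsub>B\<^esub>, \<one>\<^bsub>B\<^esub>), False)\<rparr>"

fun hurwitz_act_distinct ::
    "('a, 'b) monoid_scheme \<Rightarrow> (braid_word set \<times> braid_word set) \<times> ('a \<Rightarrow> 'a) \<Rightarrow>
     'a list \<times> 'a list \<Rightarrow> 'a list \<times> 'a list" where
  "hurwitz_act_distinct G ((\<gamma>1, \<gamma>2), \<phi>) (T1, T2) =
     (map \<phi> (braid_act G \<gamma>1 T1), map \<phi> (braid_act G \<gamma>2 T2))"

fun hurwitz_act_equal ::
    "('a, 'b) monoid_scheme \<Rightarrow> ((braid_word set \<times> braid_word set) \<times> bool) \<times> ('a \<Rightarrow> 'a) \<Rightarrow>
     'a list \<times> 'a list \<Rightarrow> 'a list \<times> 'a list" where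
  "hurwitz_act_equal G ((\<gamma>, e), \<phi>) (T1, T2) =
     hurwitz_act_distinct G (\<gamma>, \<phi>) (if e then (T2, T1) else (T1, T2))"

definition hurwitz_components :: "('a, 'b) monoid_scheme \<Rightarrow> nat list \<Rightarrow> nat list \<Rightarrow> nat" where
  "hurwitz_components G \<tau>1 \<tau>2 =
     (if \<tau>1 \<noteq> \<tau>2
      then card (orbits
        ((braid_group (length \<tau>1) \<times>\<times> braid_group (length \<tau>2)) \<times>\<times> AutoGroup G)
        (U_set G \<tau>1 \<tau>2) (hurwitz_act_distinct G))
      else card (orbits
        (wreath_Z2 (braid_group (length \<tau>1)) \<times>\<times> AutoGroup G)
        (U_set G \<tau>1 \<tau>2) (hurwitz_act_equal G)))"

end

theory Submission
  imports Defs
begin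

text \<open>
  Write \<open>\<Theta>(\<tau>) = - 2 + (1 - 1/m\<^sub>1) + \<dots> + (1 - 1/m\<^sub>r)\<close> for a type \<open>\<tau> = (m\<^sub>1, \<dots>, m\<^sub>r)\<close>, so that
  \<open>4 \<chi>(S) = |G| \<Theta>(\<tau>\<^sub>1) \<Theta>(\<tau>\<^sub>2)\<close>. Both parts rest on the fact that, once the length \<open>r\<close> is fixed,
  \<open>\<Theta>(\<tau>)\<close> lies between two positive constants as soon as it is positive, which the condition on
  the genera guarantees. The upper bound \<open>r\<close> is clear. For the lower bound, a sum of \<open>r\<close> unit
  fractions that is less than a number \<open>t\<close> cannot be arbitrarily close to \<open>t\<close>: unit fractions
  accumulate only at \<open>0\<close> and only from above, hence their sums accumulate only from above
  (\<open>unit_fraction_sums_gap_below\<close>). Taking \<open>t = r - 2\<close> bounds \<open>\<Theta>\<close> away from \<open>0\<close>.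

  For the Hurwitz components, no more than the size of \<open>\<U>(G; \<tau>\<^sub>1, \<tau>\<^sub>2)\<close> enters, since there are
  at most as many orbits as points. The relation \<open>c\<^sub>1 \<cdots> c\<^sub>r = 1\<close> recovers \<open>c\<^sub>1\<close> from the other
  entries, so there are at most \<open>|G|\<^bsup>r-1\<^esup>\<close> systems of length \<open>r\<close> and thus at most
  \<open>|G|\<^bsup>r\<^sub>1+r\<^sub>2-2\<^esup>\<close> pairs; the first part turns powers of \<open>|G|\<close> into powers of \<open>\<chi>(S)\<close>.
\<close>

text \<open>By induction on the number of summands. Let \<open>c\<close> be the gap below \<open>t\<close> for the sums without the
  first term. A first term of size at most \<open>c / 2\<close> leaves a gap of \<open>c / 2\<close>; a larger first term
  \<open>1 / m\<close> has one of finitely many denominators, and for each of them the gap below \<open>t - 1 / m\<close>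
  applies to the remaining sum.\<close>

lemma unit_fraction_sums_gap_below:
  fixes t :: real
  shows "\<exists>c>0. \<forall>ms::nat list. length ms = r \<longrightarrow> (\<Sum>m\<leftarrow>ms. 1 / real m) < t \<longrightarrow>
           (\<Sum>m\<leftarrow>ms. 1 / real m) \<le> t - c"
proof (induction r arbitrary: t)
  case 0
  show ?case
    by (rule exI[of _ "if t > 0 then t else 1"]) auto
next
  case (Suc r)
  obtain c where c: "c > 0"
    "\<And>ms. length ms = r \<Longrightarrow> (\<Sum>m\<leftarrow>ms. 1 / real m) < t \<Longrightarrow> (\<Sum>m\<leftarrow>ms. 1 / real m) \<le> t - c"
    using Suc.IH[of t] by blast
  obtain d where d: "\<And>m. d m > 0"
    "\<And>m ms. length ms = r \<Longrightarrow> (\<Sum>m\<leftarrow>ms. 1 / real m) < t - 1 / real m \<Longrightarrow>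
      (\<Sum>m\<leftarrow>ms. 1 / real m) \<le> t - 1 / real m - d m"
    using Suc.IH[of "t - 1 / real m" for m] by metis
  define N where "N = nat \<lceil>2 / c\<rceil>"
  define e where "e = Min (insert (c / 2) (d ` {..N}))"
  have e_pos: "e > 0"
    using c(1) d(1) by (simp add: e_def)
  have e_le: "e \<le> c / 2" "\<And>m. m \<le> N \<Longrightarrow> e \<le> d m"
    unfolding e_def by (rule Min_le; force)+
  have "(\<Sum>k\<leftarrow>m # ms. 1 / real k) \<le> t - e"
    if len: "length ms = r" and less: "(\<Sum>k\<leftarrow>m # ms. 1 / real k) < t" for m ms
  proof (cases "m \<le> N")
    case True
    then show ?thesis
      using d(2)[of ms m] e_le(2)[of m] len less by auto
  next
    case False
    then have m: "real m > 2 / c"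
      unfolding N_def by linarith
    then have "real m > 0"
      using c(1) by (meson divide_pos_pos less_trans zero_less_numeral)
    with m have "1 / real m \<le> c / 2"
      using c(1) by (simp add: field_simps)
    moreover have "(\<Sum>k\<leftarrow>ms. 1 / real k) \<le> t - c"
    proof (rule c(2)[OF len])
      have "(\<Sum>k\<leftarrow>ms. 1 / real k) \<le> (\<Sum>k\<leftarrow>m # ms. 1 / real k)" by simp
      with less show "(\<Sum>k\<leftarrow>ms. 1 / real k) < t" by linarith
    qed
    ultimately show ?thesis
      using e_le(1) by simp
  qed
  with e_pos show ?case
    by (intro exI[of _ e]) (auto simp: length_Suc_conv)
qed

text \<open>This is minus the orbifold Euler characteristic of the projective line with cone points of
  orders \<open>\<tau>\<close>.\<close>

definition hyperbolic_excess :: "nat list \<Rightarrow> real" where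
  "hyperbolic_excess \<tau> = - 2 + (\<Sum>l<length \<tau>. 1 - 1 / real (\<tau> ! l))"

lemma hyperbolic_excess_eq:
  "hyperbolic_excess \<tau> = real (length \<tau>) - 2 - (\<Sum>m\<leftarrow>\<tau>. 1 / real m)"
  by (simp add: hyperbolic_excess_def sum_subtractf sum_list_sum_nth atLeast0LessThan)

lemma hyperbolic_excess_le: "hyperbolic_excess \<tau> \<le> real (length \<tau>)"
proof -
  have "0 \<le> (\<Sum>m\<leftarrow>\<tau>. 1 / real m)"
    by (rule sum_list_nonneg) auto
  then show ?thesis
    by (simp add: hyperbolic_excess_eq)
qed

lemma hyperbolic_excess_bounded_below:
  "\<exists>c>0. \<forall>\<tau>. length \<tau> = r \<longrightarrow> hyperbolic_excess \<tau> > 0 \<longrightarrow> hyperbolic_excess \<tau> \<ge> c"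
proof -
  obtain c where "c > 0" and c: "\<And>\<tau>. length \<tau> = r \<Longrightarrow> (\<Sum>m\<leftarrow>\<tau>. 1 / real m) < real r - 2 \<Longrightarrow>
      (\<Sum>m\<leftarrow>\<tau>. 1 / real m) \<le> real r - 2 - c"
    using unit_fraction_sums_gap_below[of r "real r - 2"] by blast
  moreover have "hyperbolic_excess \<tau> \<ge> c"
    if "length \<tau> = r" "hyperbolic_excess \<tau> > 0" for \<tau>
    using c[of \<tau>] that by (simp add: hyperbolic_excess_eq)
  ultimately show ?thesis by blast
qed

lemma hyperbolic_excess_pos_if_genus_ge_2:
  assumes "covering_genus G \<tau> \<ge> 2"
  shows "hyperbolic_excess \<tau> > 0"
proof -
  have "real (order G) * hyperbolic_excess \<tau> > 0"
    using assms by (simp add: covering_genus_def hyperbolic_excess_def)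
  then show ?thesis
    by (simp add: zero_less_mult_iff)
qed

lemma isogenous_to_product_hyperbolic_excess_pos:
  assumes "isogenous_to_product_q0 G \<tau>1 \<tau>2 S"
  shows "hyperbolic_excess \<tau>1 > 0" "hyperbolic_excess \<tau>2 > 0"
  using assms hyperbolic_excess_pos_if_genus_ge_2
  by (auto simp: isogenous_to_product_q0_def unmixed_ramification_structure_def)

lemma length_pos_if_hyperbolic_excess_pos:
  "hyperbolic_excess \<tau> > 0 \<Longrightarrow> length \<tau> > 0"
  using hyperbolic_excess_le[of \<tau>] by linarith

text \<open>The constants must be uniform in the types: along a family of surfaces the branching indices can
  grow with the group, and only the numbers of branch points stay fixed.\<close>

lemma chi_linear_in_order:
  "\<exists>c>0. \<forall>(G :: 'a monoid) \<tau>1 \<tau>2 S.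
     length \<tau>1 = r1 \<longrightarrow> length \<tau>2 = r2 \<longrightarrow> isogenous_to_product_q0 G \<tau>1 \<tau>2 S \<longrightarrow>
     c * real (order G) \<le> chi S \<and> chi S \<le> real (r1 * r2) * real (order G)"
proof -
  obtain c1 where c1: "c1 > 0"
    "\<And>\<tau>. length \<tau> = r1 \<Longrightarrow> hyperbolic_excess \<tau> > 0 \<Longrightarrow> hyperbolic_excess \<tau> \<ge> c1"
    using hyperbolic_excess_bounded_below by blast
  obtain c2 where c2: "c2 > 0"
    "\<And>\<tau>. length \<tau> = r2 \<Longrightarrow> hyperbolic_excess \<tau> > 0 \<Longrightarrow> hyperbolic_excess \<tau> \<ge> c2"
    using hyperbolic_excess_bounded_below by blast
  have "c1 * c2 / 4 * real (order G) \<le> chi S \<and> chi S \<le> real (r1 * r2) * real (order G)"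
    if r: "length \<tau>1 = r1" "length \<tau>2 = r2" and S: "isogenous_to_product_q0 G \<tau>1 \<tau>2 S"
    for G :: "'a monoid" and \<tau>1 \<tau>2 S
  proof -
    let ?p = "hyperbolic_excess \<tau>1 * hyperbolic_excess \<tau>2"
    note pos = isogenous_to_product_hyperbolic_excess_pos[OF S]
    have chi: "4 * chi S = real (order G) * ?p"
      using four_chi[OF S] by (simp add: hyperbolic_excess_def)
    have "c1 * c2 \<le> ?p"
      using pos c1 c2 r by (intro mult_mono) auto
    moreover have "?p \<le> real r1 * real r2"
      using pos hyperbolic_excess_le[of \<tau>1] hyperbolic_excess_le[of \<tau>2] r
      by (intro mult_mono) auto
    ultimately have "real (order G) * (c1 * c2) \<le> 4 * chi S"
      "4 * chi S \<le> real (order G) * (real r1 * real r2)"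
      unfolding chi by (auto intro: mult_left_mono)
    moreover have "0 \<le> real (order G) * (real r1 * real r2)"
      by simp
    ultimately have "real (order G) * (c1 * c2) \<le> 4 * chi S"
      "chi S \<le> real (order G) * (real r1 * real r2)"
      by linarith+
    then show ?thesis
      by (simp add: mult_ac)
  qed
  then show ?thesis
    using c1(1) c2(1) by (intro exI[of _ "c1 * c2 / 4"]) auto
qed

text \<open>The first entry of such a tuple is the inverse of the product of the others, so dropping it
  loses nothing. For \<open>r = 0\<close> the truncated exponent \<open>r - 1 = 0\<close> still gives the correct bound \<open>1\<close>
  on the number of empty tuples.\<close>

lemma (in group) card_tuples_with_product_one:
  assumes "finite (carrier G)"
  shows "finite {V. set V \<subseteq> carrier G \<and> length V = r \<and> foldr (\<otimes>) V \<one> = \<one>}"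
    and "card {V. set V \<subseteq> carrier G \<and> length V = r \<and> foldr (\<otimes>) V \<one> = \<one>} \<le> order G ^ (r - 1)"
proof -
  let ?V = "{V. set V \<subseteq> carrier G \<and> length V = r \<and> foldr (\<otimes>) V \<one> = \<one>}"
  let ?W = "{W. set W \<subseteq> carrier G \<and> length W = r - 1}"
  have closed: "foldr (\<otimes>) W \<one> \<in> carrier G" if "set W \<subseteq> carrier G" for W
    using that by (induction W) auto
  have inj: "inj_on tl ?V"
  proof (rule inj_onI)
    fix V V' assume VV': "V \<in> ?V" "V' \<in> ?V" "tl V = tl V'"
    show "V = V'"
    proof (cases r)
      case 0
      with VV' show ?thesis by simp
    next
      case (Suc k)
      with VV' obtain x x' W where *: "V = x # W" "V' = x' # W"
        by (cases V; cases V') auto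
      with VV' have "x \<otimes> foldr (\<otimes>) W \<one> = x' \<otimes> foldr (\<otimes>) W \<one>" "x \<in> carrier G" "x' \<in> carrier G"
        "foldr (\<otimes>) W \<one> \<in> carrier G"
        using closed[of W] by auto
      with * show ?thesis by simp
    qed
  qed
  have sub: "tl ` ?V \<subseteq> ?W"
  proof (rule image_subsetI)
    fix V assume "V \<in> ?V"
    then show "tl V \<in> ?W" by (cases V) auto
  qed
  have fin: "finite ?W"
    using finite_lists_length_eq[OF assms] .
  show "finite ?V"
    using inj sub fin by (rule inj_on_finite)
  show "card ?V \<le> order G ^ (r - 1)"
    using card_inj_on_le[OF inj sub fin] card_lists_length_eq[OF assms, of "r - 1"]
    by (simp add: order_def)
qed

lemma (in group) U_set_card_le:
  assumes "finite (carrier G)"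
  shows "finite (U_set G \<tau>1 \<tau>2)"
    and "card (U_set G \<tau>1 \<tau>2) \<le> order G ^ (length \<tau>1 - 1) * order G ^ (length \<tau>2 - 1)"
proof -
  let ?V = "\<lambda>r. {V. set V \<subseteq> carrier G \<and> length V = r \<and> foldr (\<otimes>) V \<one> = \<one>}"
  have sub: "U_set G \<tau>1 \<tau>2 \<subseteq> ?V (length \<tau>1) \<times> ?V (length \<tau>2)"
    by (auto simp: U_set_def system_of_unordered_type_def generating_tuple_def)
  have fin: "finite (?V (length \<tau>1) \<times> ?V (length \<tau>2))"
    using card_tuples_with_product_one(1)[OF assms] by blast
  show "finite (U_set G \<tau>1 \<tau>2)"
    using sub fin by (rule finite_subset)
  have "card (U_set G \<tau>1 \<tau>2) \<le> card (?V (length \<tau>1)) * card (?V (length \<tau>2))"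
    using card_mono[OF fin sub] by (simp add: card_cartesian_product)
  also have "\<dots> \<le> order G ^ (length \<tau>1 - 1) * order G ^ (length \<tau>2 - 1)"
    using card_tuples_with_product_one(2)[OF assms] by (intro mult_le_mono)
  finally show "card (U_set G \<tau>1 \<tau>2) \<le> order G ^ (length \<tau>1 - 1) * order G ^ (length \<tau>2 - 1)" .
qed

lemma card_orbits_le:
  assumes "finite E"
  shows "card (orbits A E \<phi>) \<le> card E"
proof -
  have "orbits A E \<phi> = orbit A \<phi> ` E"
    by (auto simp: orbits_def)
  then show ?thesis
    using card_image_le[OF assms] by simp
qed

lemma (in group) hurwitz_components_le:
  assumes "finite (carrier G)"
  shows "hurwitz_components G \<tau>1 \<tau>2 \<le> order G ^ (length \<tau>1 - 1) * order G ^ (length \<tau>2 - 1)"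
proof -
  note U = U_set_card_le[OF assms, of \<tau>1 \<tau>2]
  have "hurwitz_components G \<tau>1 \<tau>2 \<le> card (U_set G \<tau>1 \<tau>2)"
    by (simp add: hurwitz_components_def card_orbits_le[OF U(1)]
        card_orbits_le[OF U_set_card_le(1)[OF assms]])
  with U(2) show ?thesis by simp
qed

theorem proposition4p2:
  fixes r1 r2 :: nat
    and G :: "nat \<Rightarrow> 'a monoid"
    and \<tau>1 \<tau>2 :: "nat \<Rightarrow> nat list"
    and S :: "nat \<Rightarrow> 'a product_quotient"
  assumes "\<And>n. n \<ge> 1 \<Longrightarrow> group (G n) \<and> finite (carrier (G n))"
    and "\<And>n. n \<ge> 1 \<Longrightarrow> admits_unmixed_ramification_structure_of_size (G n) r1 r2"
    and "\<And>n. n \<ge> 1 \<Longrightarrow> length (\<tau>1 n) = r1 \<and> length (\<tau>2 n) = r2"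
    and "\<And>n. n \<ge> 1 \<Longrightarrow> type_of_unmixed_ramification_structure (G n) (\<tau>1 n) (\<tau>2 n)"
    and "\<And>n. n \<ge> 1 \<Longrightarrow> isogenous_to_product_q0 (G n) (\<tau>1 n) (\<tau>2 n) (S n)"
    and "filterlim (\<lambda>n. order (G n)) at_top at_top"
  shows "(\<lambda>n. chi (S n)) \<in> \<Theta>(\<lambda>n. real (order (G n))) \<and>
         (\<lambda>n. real (hurwitz_components (G n) (\<tau>1 n) (\<tau>2 n)))
           \<in> O(\<lambda>n. chi (S n) ^ (r1 + r2 - 2))"
proof -
  obtain c where c: "c > 0" and chi:
    "\<And>n. n \<ge> 1 \<Longrightarrow> c * real (order (G n)) \<le> chi (S n)"
    "\<And>n. n \<ge> 1 \<Longrightarrow> chi (S n) \<le> real (r1 * r2) * real (order (G n))"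
    using chi_linear_in_order[of r1 r2] assms(3,5) by metis
  have chi_nonneg: "chi (S n) \<ge> 0" if "n \<ge> 1" for n
  proof -
    have "0 \<le> c * real (order (G n))" using c by simp
    with chi(1)[OF that] show ?thesis by linarith
  qed
  have Theta: "(\<lambda>n. chi (S n)) \<in> \<Theta>(\<lambda>n. real (order (G n)))"
  proof (rule bigthetaI)
    show "(\<lambda>n. chi (S n)) \<in> O(\<lambda>n. real (order (G n)))"
      using chi(2) chi_nonneg
      by (intro bigoI[of _ "real (r1 * r2)"] eventually_at_top_linorderI[of 1]) auto
    show "(\<lambda>n. chi (S n)) \<in> \<Omega>(\<lambda>n. real (order (G n)))"
      using chi(1) chi_nonneg c
      by (intro landau_omega.bigI[of c] eventually_at_top_linorderI[of 1]) auto
  qed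
  have h: "hurwitz_components (G n) (\<tau>1 n) (\<tau>2 n) \<le> order (G n) ^ (r1 + r2 - 2)"
    if n: "n \<ge> 1" for n
  proof -
    have len: "length (\<tau>1 n) = r1" "length (\<tau>2 n) = r2"
      using assms(3)[OF n] by auto
    (* Positive lengths make the truncated exponents r1 - 1 and r2 - 1 add up correctly. *)
    then have "r1 > 0" "r2 > 0"
      using isogenous_to_product_hyperbolic_excess_pos[OF assms(5)[OF n]]
        length_pos_if_hyperbolic_excess_pos by blast+
    then have "(r1 - 1) + (r2 - 1) = r1 + r2 - 2"
      by simp
    moreover have "hurwitz_components (G n) (\<tau>1 n) (\<tau>2 n)
        \<le> order (G n) ^ (r1 - 1) * order (G n) ^ (r2 - 1)"
      using group.hurwitz_components_le[of "G n" "\<tau>1 n" "\<tau>2 n"] assms(1)[OF n] len by simp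
    ultimately show ?thesis
      by (metis power_add)
  qed
  have "(\<lambda>n. real (hurwitz_components (G n) (\<tau>1 n) (\<tau>2 n)))
      \<in> O(\<lambda>n. real (order (G n)) ^ (r1 + r2 - 2))"
  proof (intro bigoI[of _ 1] eventually_at_top_linorderI[of 1])
    fix n :: nat assume "n \<ge> 1"
    from h[OF this] have "real (hurwitz_components (G n) (\<tau>1 n) (\<tau>2 n))
        \<le> real (order (G n)) ^ (r1 + r2 - 2)"
      by (metis of_nat_le_iff of_nat_power)
    then show "norm (real (hurwitz_components (G n) (\<tau>1 n) (\<tau>2 n)))
        \<le> 1 * norm (real (order (G n)) ^ (r1 + r2 - 2))"
      by simp
  qed
  also have "(\<lambda>n. real (order (G n)) ^ (r1 + r2 - 2)) \<in> O(\<lambda>n. chi (S n) ^ (r1 + r2 - 2))"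
    using Theta by (intro landau_o.big_power) (simp add: bigtheta_def bigomega_iff_bigo)
  finally show ?thesis
    using Theta by simp
qed

end
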